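(* Let $\bm{A}_f\in\mathbb{R}^{m\times n}$, let $\bm{D}\in\mathbb{R}^{n\times n_c}$, let $\bm{A}_c=\bm{A}_f\bm{D}\in\mathbb{R}^{m\times n_c}$ be a coarse grid sketch of full column rank, and let $1\le k<n_c$. Let $\bm{M}\in\mathbb{R}^{n_c\times n}$ and $\bm{E}_I\in\mathbb{R}^{m\times n}$ satisfy $\bm{A}_f=\bm{A}_c\bm{M}+\bm{E}_I$. Let $\hat{\bm{A}}_f$ be the rank-$k$ approximation of $\bm{A}_f$ generated by SPC-SVD (defined in the context). Then $$\Vert\bm{A}_f-\hat{\bm{A}}_f\Vert_2\le\sigma_{f,k+1}+\Vert\bm{E}_I\Vert_2,$$ where $\sigma_{f,k+1}$ is the $(k+1)$-th largest singular value of $\bm{A}_f$.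
   Context: $\Vert\cdot\Vert_2$ is the matrix 2-norm (spectral norm). A coarse grid sketch of the fine grid data matrix $\bm{A}_f$ is a matrix $\bm{A}_c=\bm{A}_f\bm{D}$ for a fixed (deterministic) matrix $\bm{D}$. SPC-SVD (without the optional random projection): form $\bm{A}_c=\bm{A}_f\bm{D}$ and $\bm{H}=\bm{A}_f^T\bm{A}_c$; compute the thin QR decomposition $\bm{A}_c=\bm{Q}_c\bm{R}_c$, where $\bm{Q}_c\in\mathbb{R}^{m\times n_c}$ has orthonormal columns and $\bm{R}_c\in\mathbb{R}^{n_c\times n_c}$ is upper triangular and invertible; compute a singular value decomposition $(\bm{H}\bm{R}_c^{-1})^T=\bm{U}\bm{S}\bm{V}^T$ with singular values in non-increasing order (note $(\bm{H}\bm{R}_c^{-1})^T=\bm{Q}_c^T\bm{A}_f$); the output is $\hat{\bm{A}}_f=\bm{Q}_c\tilde{\bm{U}}_k\tilde{\bm{S}}_k\tilde{\bm{V}}_k^T$, where $\tilde{\bm{U}}_k,\tilde{\bm{V}}_k$ are the first $k$ columns of $\bm{U},\bm{V}$ and $\tilde{\bm{S}}_k$ is the leading $k\times k$ block of $\bm{S}$. *)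

theory Defs
  imports
    "Jordan_Normal_Form.DL_Rank"
    "Jordan_Normal_Form.Char_Poly"
    "HOL-Computational_Algebra.Polynomial"
begin

definition vec_norm2 :: "real vec \<Rightarrow> real" where
  "vec_norm2 v = sqrt (v \<bullet> v)"

definition spectral_norm :: "real mat \<Rightarrow> real" where
  "spectral_norm A =
     Sup {vec_norm2 (A *\<^sub>v x) | x. x \<in> carrier_vec (dim_col A) \<and> vec_norm2 x \<le> 1}"

text \<open>
  The singular values of an $m \times n$ matrix in non-increasing order: the square roots of the
  $\min(m,n)$ largest eigenvalues of $A^T A$, counted with (algebraic) multiplicity. If $n > m$,
  the remaining $n - m$ eigenvalues of $A^T A$ are zero and are dropped.
\<close>

definition singular_values :: "real mat \<Rightarrow> real list" where
  "singular_values A =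
     take (min (dim_row A) (dim_col A))
       (map sqrt (rev (sorted_list_of_multiset (proots (char_poly (A\<^sup>T * A))))))"

text \<open>The \<open>j\<close>-th largest singular value, counting from 1, for \<open>1 \<le> j \<le> min m n\<close>.\<close>

definition singular_value :: "real mat \<Rightarrow> nat \<Rightarrow> real" where
  "singular_value A j = singular_values A ! (j - 1)"

definition orthonormal_cols :: "real mat \<Rightarrow> bool" where
  "orthonormal_cols Q \<longleftrightarrow> Q\<^sup>T * Q = 1\<^sub>m (dim_col Q)"

definition thin_qr :: "real mat \<Rightarrow> real mat \<Rightarrow> real mat \<Rightarrow> bool" where
  "thin_qr A Q R \<longleftrightarrow>
     Q \<in> carrier_mat (dim_row A) (dim_col A) \<and> R \<in> carrier_mat (dim_col A) (dim_col A) \<and>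
     orthonormal_cols Q \<and> upper_triangular R \<and> invertible_mat R \<and> A = Q * R"

text \<open>
  A full singular value decomposition: \<open>U\<close> and \<open>V\<close> are square and orthogonal, \<open>S\<close> is rectangular.
\<close>

definition is_svd :: "real mat \<Rightarrow> real mat \<Rightarrow> real mat \<Rightarrow> real mat \<Rightarrow> bool" where
  "is_svd A U S V \<longleftrightarrow>
     U \<in> carrier_mat (dim_row A) (dim_row A) \<and> S \<in> carrier_mat (dim_row A) (dim_col A) \<and>
     V \<in> carrier_mat (dim_col A) (dim_col A) \<and>
     orthonormal_cols U \<and> orthonormal_cols V \<and> diagonal_mat S \<and>
     (\<forall>i < min (dim_row A) (dim_col A). S $$ (i, i) \<ge> 0) \<and>
     (\<forall>i j. i \<le> j \<longrightarrow> j < min (dim_row A) (dim_col A) \<longrightarrow> S $$ (j, j) \<le> S $$ (i, i)) \<and>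
     A = U * S * V\<^sup>T"

definition leading_block :: "nat \<Rightarrow> nat \<Rightarrow> 'a mat \<Rightarrow> 'a mat" where
  "leading_block r c A = mat r c (\<lambda>(i, j). A $$ (i, j))"

definition leading_cols :: "nat \<Rightarrow> 'a mat \<Rightarrow> 'a mat" where
  "leading_cols k A = leading_block (dim_row A) k A"

text \<open>
  SPC-SVD is a relation rather than a function, since the QR decomposition and the singular value
  decomposition it computes are not unique: \<open>spc_svd Af D k Ahat\<close> says that \<open>Ahat\<close> is a possible
  rank-\<open>k\<close> output on the data matrix \<open>Af\<close> with sketching matrix \<open>D\<close>.
\<close>

definition spc_svd :: "real mat \<Rightarrow> real mat \<Rightarrow> nat \<Rightarrow> real mat \<Rightarrow> bool" where
  "spc_svd Af D k Ahat \<longleftrightarrow>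
     (\<exists>Ac H Qc Rc Rinv U S V.
        Ac = Af * D \<and> H = Af\<^sup>T * Ac \<and>
        thin_qr Ac Qc Rc \<and>
        Rinv \<in> carrier_mat (dim_col Ac) (dim_col Ac) \<and> inverts_mat Rc Rinv \<and> inverts_mat Rinv Rc \<and>
        is_svd ((H * Rinv)\<^sup>T) U S V \<and>
        Ahat = Qc * leading_cols k U * leading_block k k S * (leading_cols k V)\<^sup>T)"

end

theory Submission
  imports Defs "HOL-Analysis.L2_Norm"
begin

text \<open>
  Write \<open>Q\<close> for the orthonormal factor of \<open>A\<^sub>c\<close>, so that SPC-SVD truncates the singular value
  decomposition of \<open>B = Q\<^sup>T A\<^sub>f\<close> to a matrix \<open>B\<^sub>k\<close> and returns \<open>Q B\<^sub>k\<close>. The error splits as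
  \[ A_f - Q B_k = (A_f - Q Q^T A_f) + Q (B - B_k). \]
  The first part is the residual of the orthogonal projection onto the range of \<open>A\<^sub>c\<close>. This
  projection fixes \<open>A\<^sub>c M\<close>, so the residual only sees \<open>E\<^sub>I\<close>
  (\<open>projection_residual_add_range\<close>), and taking a residual never lengthens a vector
  (\<open>vec_norm2_projection_residual_le\<close>): this part is at most the norm of \<open>E\<^sub>I\<close>.

  The second part has the norm of \<open>B - B\<^sub>k\<close>, which is at most the \<open>(k+1)\<close>-st singular value of
  \<open>B\<close> (\<open>svd_truncation_error\<close>). As \<open>B x = Q\<^sup>T (A\<^sub>f x)\<close> is never longer than \<open>A\<^sub>f x\<close>, the min-max
  principle bounds it by the \<open>(k+1)\<close>-st singular value of \<open>A\<^sub>f\<close>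
  (\<open>compressed_singular_value_le\<close>).

  Singular values of \<open>A\<^sub>f\<close> are square roots of the sorted roots of the characteristic polynomial of
  \<open>A\<^sub>f\<^sup>T A\<^sub>f\<close>, with multiplicity. The min-max principle therefore rests on a spectral theorem for real
  symmetric matrices in which the eigenvalues appear on the diagonal in a prescribed order, here
  non-increasing (\<open>real_symmetric_diagonalization\<close>, by deflation with Householder reflections).
  A dimension count then finishes it: a subspace of dimension \<open>k+1\<close> contains a nonzero vector
  orthogonal to the first \<open>k\<close> eigenvectors (\<open>min_max_lower_bound\<close>).
\<close>

section \<open>The Euclidean norm and the spectral norm\<close>

lemma scalar_prod_self_nonneg: "0 \<le> v \<bullet> (v :: real vec)"
  by (simp add: scalar_prod_def sum_nonneg)

lemma vec_norm2_power2: "(vec_norm2 v)\<^sup>2 = v \<bullet> v"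
  by (simp add: vec_norm2_def scalar_prod_self_nonneg)

lemma vec_norm2_nonneg: "0 \<le> vec_norm2 v"
  by (simp add: vec_norm2_def scalar_prod_self_nonneg)

lemma vec_norm2_eq_L2_set: "vec_norm2 v = L2_set (\<lambda>i. v $ i) {0..<dim_vec v}"
  by (simp add: vec_norm2_def L2_set_def scalar_prod_def power2_eq_square)

lemma scalar_prod_self_eq_sum:
  assumes "v \<in> carrier_vec n"
  shows "v \<bullet> (v :: real vec) = (\<Sum>i<n. (v $ i)\<^sup>2)"
  using assms by (simp add: scalar_prod_def power2_eq_square lessThan_atLeast0)

lemma scalar_prod_self_pos:
  assumes v: "v \<in> carrier_vec n" and "v \<noteq> 0\<^sub>v n"
  shows "0 < v \<bullet> (v :: real vec)"
proof -
  obtain i where i: "i < n" "v $ i \<noteq> 0"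
    using assms by (metis carrier_vecD eq_vecI index_zero_vec)
  then show ?thesis
    unfolding scalar_prod_self_eq_sum[OF v] by (intro sum_pos2[of _ i]) auto
qed

lemma vec_norm2_triangle:
  assumes "v \<in> carrier_vec n" "w \<in> carrier_vec n"
  shows "vec_norm2 (v + w) \<le> vec_norm2 v + vec_norm2 w"
proof -
  have "vec_norm2 (v + w) = L2_set (\<lambda>i. v $ i + w $ i) {0..<n}"
    using assms unfolding vec_norm2_eq_L2_set by (intro L2_set_cong) auto
  then show ?thesis
    using assms L2_set_triangle_ineq[of "\<lambda>i. v $ i" "\<lambda>i. w $ i" "{0..<n}"]
    by (simp add: vec_norm2_eq_L2_set)
qed

lemma Cauchy_Schwarz_vec:
  assumes "v \<in> carrier_vec n" "w \<in> carrier_vec n"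
  shows "\<bar>v \<bullet> w\<bar> \<le> vec_norm2 v * vec_norm2 w"
proof -
  have "\<bar>v \<bullet> w\<bar> \<le> (\<Sum>i\<in>{0..<n}. \<bar>v $ i\<bar> * \<bar>w $ i\<bar>)"
    using assms by (auto simp: scalar_prod_def abs_mult[symmetric])
  also have "\<dots> \<le> L2_set (\<lambda>i. v $ i) {0..<n} * L2_set (\<lambda>i. w $ i) {0..<n}"
    by (rule L2_set_mult_ineq)
  finally show ?thesis
    using assms by (simp add: vec_norm2_eq_L2_set)
qed

text \<open>The crude bound by the sum of the row norms serves only to make the supremum that defines the
  spectral norm a supremum of a bounded set.\<close>

lemma vec_norm2_mult_mat_vec_le:
  assumes "x \<in> carrier_vec (dim_col A)" and "vec_norm2 x \<le> 1"
  shows "vec_norm2 (A *\<^sub>v x) \<le> (\<Sum>i<dim_row A. vec_norm2 (row A i))"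
proof -
  have "vec_norm2 (A *\<^sub>v x) \<le> (\<Sum>i<dim_row A. \<bar>(A *\<^sub>v x) $ i\<bar>)"
    unfolding vec_norm2_eq_L2_set using L2_set_le_sum_abs[of "\<lambda>i. (A *\<^sub>v x) $ i" "{..<dim_row A}"]
    by (simp add: lessThan_atLeast0 cong: sum.cong)
  also have "\<dots> \<le> (\<Sum>i<dim_row A. vec_norm2 (row A i))"
  proof (rule sum_mono)
    fix i assume i: "i \<in> {..<dim_row A}"
    then have "\<bar>(A *\<^sub>v x) $ i\<bar> = \<bar>row A i \<bullet> x\<bar>" by simp
    also have "\<dots> \<le> vec_norm2 (row A i) * vec_norm2 x"
      using assms by (intro Cauchy_Schwarz_vec[of _ "dim_col A"]) auto
    also have "\<dots> \<le> vec_norm2 (row A i)"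
      using assms(2) vec_norm2_nonneg by (simp add: mult_left_le)
    finally show "\<bar>(A *\<^sub>v x) $ i\<bar> \<le> vec_norm2 (row A i)" .
  qed
  finally show ?thesis .
qed

lemma vec_norm2_le_spectral_norm:
  assumes "x \<in> carrier_vec (dim_col A)" and "vec_norm2 x \<le> 1"
  shows "vec_norm2 (A *\<^sub>v x) \<le> spectral_norm A"
  unfolding spectral_norm_def
proof (rule cSup_upper)
  show "bdd_above {vec_norm2 (A *\<^sub>v x) |x. x \<in> carrier_vec (dim_col A) \<and> vec_norm2 x \<le> 1}"
    using vec_norm2_mult_mat_vec_le by (auto intro!: bdd_aboveI)
qed (use assms in blast)

lemma spectral_norm_least:
  assumes "\<And>x. x \<in> carrier_vec (dim_col A) \<Longrightarrow> vec_norm2 x \<le> 1 \<Longrightarrow> vec_norm2 (A *\<^sub>v x) \<le> c"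
  shows "spectral_norm A \<le> c"
  unfolding spectral_norm_def
proof (rule cSup_least)
  have "vec_norm2 (0\<^sub>v (dim_col A)) \<le> 1"
    by (simp add: vec_norm2_def)
  then show "{vec_norm2 (A *\<^sub>v x) |x. x \<in> carrier_vec (dim_col A) \<and> vec_norm2 x \<le> 1} \<noteq> {}"
    using zero_carrier_vec by blast
qed (use assms in auto)

section \<open>Matrices with orthonormal columns\<close>

lemma orthonormal_cols_scalar_prod:
  assumes Q: "Q \<in> carrier_mat m n" "orthonormal_cols Q"
    and x: "x \<in> carrier_vec n" and y: "y \<in> carrier_vec n"
  shows "(Q *\<^sub>v x) \<bullet> (Q *\<^sub>v y) = x \<bullet> y"
proof -
  have "(Q *\<^sub>v x) \<bullet> (Q *\<^sub>v y) = x \<bullet> (Q\<^sup>T *\<^sub>v (Q *\<^sub>v y))"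
    using transpose_vec_mult_scalar[of "Q\<^sup>T" n m "Q *\<^sub>v y" x] Q x y by simp
  also have "Q\<^sup>T *\<^sub>v (Q *\<^sub>v y) = (Q\<^sup>T * Q) *\<^sub>v y"
    using Q y by (intro assoc_mult_mat_vec[symmetric]) auto
  also have "\<dots> = y"
    using Q y by (simp add: orthonormal_cols_def)
  finally show ?thesis .
qed

lemma vec_norm2_orthonormal_cols:
  assumes "Q \<in> carrier_mat m n" "orthonormal_cols Q" "x \<in> carrier_vec n"
  shows "vec_norm2 (Q *\<^sub>v x) = vec_norm2 x"
  using orthonormal_cols_scalar_prod[OF assms assms(3)] by (simp add: vec_norm2_def)

text \<open>Pythagoras: \<open>z\<close> is the orthogonal sum of \<open>Q Q\<^sup>T z\<close>, whose length is that of \<open>Q\<^sup>T z\<close>, and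
  the residual of the projection, so neither part is longer than \<open>z\<close>.\<close>

lemma orthonormal_cols_Pythagoras:
  assumes Q: "Q \<in> carrier_mat m n" "orthonormal_cols Q" and z: "z \<in> carrier_vec m"
  shows "z \<bullet> z = (Q\<^sup>T *\<^sub>v z) \<bullet> (Q\<^sup>T *\<^sub>v z)
    + (z - Q *\<^sub>v (Q\<^sup>T *\<^sub>v z)) \<bullet> (z - Q *\<^sub>v (Q\<^sup>T *\<^sub>v z))"
proof -
  define y where "y = Q\<^sup>T *\<^sub>v z"
  have y: "y \<in> carrier_vec n" and Qy: "Q *\<^sub>v y \<in> carrier_vec m"
    using Q z by (auto simp: y_def)
  have "z \<bullet> (Q *\<^sub>v y) = y \<bullet> y"
    using transpose_vec_mult_scalar[OF Q(1) y z] by (simp add: y_def)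
  moreover have "(Q *\<^sub>v y) \<bullet> z = z \<bullet> (Q *\<^sub>v y)"
    using Qy z by (rule comm_scalar_prod)
  moreover have "(Q *\<^sub>v y) \<bullet> (Q *\<^sub>v y) = y \<bullet> y"
    by (rule orthonormal_cols_scalar_prod[OF Q y y])
  moreover have "(z - Q *\<^sub>v y) \<bullet> (z - Q *\<^sub>v y)
      = z \<bullet> z - z \<bullet> (Q *\<^sub>v y) - ((Q *\<^sub>v y) \<bullet> z - (Q *\<^sub>v y) \<bullet> (Q *\<^sub>v y))"
    using z Qy
    by (simp add: minus_scalar_prod_distrib[of _ m] scalar_prod_minus_distrib[of _ m])
  ultimately show ?thesis
    unfolding y_def[symmetric] by linarith
qed

lemma vec_norm2_transpose_orthonormal_le:
  assumes "Q \<in> carrier_mat m n" "orthonormal_cols Q" "z \<in> carrier_vec m"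
  shows "vec_norm2 (Q\<^sup>T *\<^sub>v z) \<le> vec_norm2 z"
  unfolding vec_norm2_def using orthonormal_cols_Pythagoras[OF assms]
  by (simp add: scalar_prod_self_nonneg)

lemma vec_norm2_projection_residual_le:
  assumes "Q \<in> carrier_mat m n" "orthonormal_cols Q" "z \<in> carrier_vec m"
  shows "vec_norm2 (z - Q *\<^sub>v (Q\<^sup>T *\<^sub>v z)) \<le> vec_norm2 z"
  unfolding vec_norm2_def using orthonormal_cols_Pythagoras[OF assms]
  by (simp add: scalar_prod_self_nonneg)

lemma orthonormal_cols_mult:
  assumes "P \<in> carrier_mat l m" "orthonormal_cols P" "Q \<in> carrier_mat m n" "orthonormal_cols Q"
  shows "orthonormal_cols (P * Q)"
proof -
  have "(P * Q)\<^sup>T * (P * Q) = Q\<^sup>T * (P\<^sup>T * (P * Q))"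
    using assms by (simp add: transpose_mult[of P l m Q n] assoc_mult_mat[of _ n m _ l _ n])
  also have "P\<^sup>T * (P * Q) = (P\<^sup>T * P) * Q"
    using assms by (intro assoc_mult_mat[symmetric]) auto
  also have "\<dots> = Q"
    using assms by (simp add: orthonormal_cols_def)
  finally show ?thesis
    using assms by (simp add: orthonormal_cols_def)
qed

lemma square_orthonormal_cols_transpose:
  assumes "Q \<in> carrier_mat n n" "orthonormal_cols Q"
  shows "Q * Q\<^sup>T = 1\<^sub>m n" and "orthonormal_cols Q\<^sup>T"
  using mat_mult_left_right_inverse[of "Q\<^sup>T" n Q] assms by (auto simp: orthonormal_cols_def)

section \<open>The spectral theorem for real symmetric matrices\<close>

text \<open>Split an eigenvector into real and imaginary parts, \<open>z = x + i y\<close>. For \<open>l = a + i b\<close> this gives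
  \<open>G x = a x - b y\<close> and \<open>G y = b x + a y\<close>, and symmetry of \<open>G\<close>, that is \<open>G y \<bullet> x = y \<bullet> G x\<close>, forces
  \<open>b (x \<bullet> x + y \<bullet> y) = 0\<close>.\<close>

lemma real_symmetric_eigenvalue_is_real:
  fixes G :: "real mat"
  assumes G: "G \<in> carrier_mat n n" and sym: "G\<^sup>T = G"
    and ev: "eigenvalue (map_mat complex_of_real G) l"
  shows "l \<in> \<real>"
proof -
  obtain z where z: "z \<in> carrier_vec n" "z \<noteq> 0\<^sub>v n"
    and Gz: "map_mat complex_of_real G *\<^sub>v z = l \<cdot>\<^sub>v z"
    using ev G unfolding eigenvalue_def eigenvector_def by auto
  define x where "x = map_vec Re z"
  define y where "y = map_vec Im z"
  have x: "x \<in> carrier_vec n" and y: "y \<in> carrier_vec n"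
    using z by (auto simp: x_def y_def)
  have entry: "(\<Sum>j = 0..<n. complex_of_real (G $$ (i, j)) * z $ j) = l * z $ i" if "i < n" for i
    using arg_cong[OF Gz, of "\<lambda>v. v $ i"] that G z by (simp add: scalar_prod_def)
  have Gx: "G *\<^sub>v x = Re l \<cdot>\<^sub>v x - Im l \<cdot>\<^sub>v y"
  proof (rule eq_vecI)
    fix i assume "i < dim_vec (Re l \<cdot>\<^sub>v x - Im l \<cdot>\<^sub>v y)"
    then have i: "i < n" using y by simp
    show "(G *\<^sub>v x) $ i = (Re l \<cdot>\<^sub>v x - Im l \<cdot>\<^sub>v y) $ i"
      using arg_cong[OF entry[OF i], of Re] i G z
      by (simp add: scalar_prod_def x_def y_def)
  qed (use G y in simp)
  have Gy: "G *\<^sub>v y = Im l \<cdot>\<^sub>v x + Re l \<cdot>\<^sub>v y"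
  proof (rule eq_vecI)
    fix i assume "i < dim_vec (Im l \<cdot>\<^sub>v x + Re l \<cdot>\<^sub>v y)"
    then have i: "i < n" using y by simp
    show "(G *\<^sub>v y) $ i = (Im l \<cdot>\<^sub>v x + Re l \<cdot>\<^sub>v y) $ i"
      using arg_cong[OF entry[OF i], of Im] i G z
      by (simp add: scalar_prod_def x_def y_def add.commute)
  qed (use G y in simp)
  have "(G *\<^sub>v y) \<bullet> x = y \<bullet> (G *\<^sub>v x)"
    using transpose_vec_mult_scalar[OF G x y] sym by simp
  then have "Im l * (x \<bullet> x + y \<bullet> y) = 0"
    using x y unfolding Gx Gy
    by (simp add: add_scalar_prod_distrib[of _ n] scalar_prod_minus_distrib[of _ n]
        comm_scalar_prod[of y n x] algebra_simps)
  moreover have "x \<bullet> x + y \<bullet> y > 0"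
  proof -
    have "x \<noteq> 0\<^sub>v n \<or> y \<noteq> 0\<^sub>v n"
    proof (rule ccontr)
      assume "\<not> ?thesis"
      then have 0: "x = 0\<^sub>v n" "y = 0\<^sub>v n" by auto
      have "z = 0\<^sub>v n"
      proof (rule eq_vecI)
        fix i assume i: "i < dim_vec (0\<^sub>v n :: complex vec)"
        have "x $ i = 0" "y $ i = 0" using 0 i by auto
        then show "z $ i = 0\<^sub>v n $ i"
          using i z by (simp add: x_def y_def complex_eq_iff)
      qed (use z in simp)
      with z show False by simp
    qed
    then show ?thesis
      using scalar_prod_self_pos[OF x] scalar_prod_self_pos[OF y]
        scalar_prod_self_nonneg[of x] scalar_prod_self_nonneg[of y] by linarith
  qed
  ultimately show ?thesis
    by (simp add: complex_is_Real_iff)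
qed

text \<open>Over the complex numbers the characteristic polynomial splits by the fundamental theorem of
  algebra; all its roots are real, so the factorization descends to the reals.\<close>

lemma real_symmetric_char_poly_splits:
  fixes G :: "real mat"
  assumes G: "G \<in> carrier_mat n n" and sym: "G\<^sup>T = G"
  obtains es where "char_poly G = (\<Prod>e\<leftarrow>es. [:- e, 1:])" and "length es = n"
proof -
  interpret mp: map_poly_inj_idom_hom complex_of_real ..
  let ?C = "map_mat complex_of_real G"
  have C: "?C \<in> carrier_mat n n" using G by simp
  obtain as where as: "char_poly ?C = (\<Prod>a\<leftarrow>as. [:- a, 1:])" "length as = n"
    using char_poly_factorized[OF C] by blast
  have "a \<in> \<real>" if "a \<in> set as" for a
  proof (rule real_symmetric_eigenvalue_is_real[OF G sym])
    show "eigenvalue ?C a"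
      unfolding eigenvalue_root_char_poly[OF C] as
      using that by (induction as) (auto simp: poly_prod_list)
  qed
  then have "map (complex_of_real \<circ> Re) as = as"
    by (intro map_idI) (auto elim: Reals_cases)
  then have "char_poly ?C = (\<Prod>a\<leftarrow>map (complex_of_real \<circ> Re) as. [:- a, 1:])"
    using as by simp
  also have "\<dots> = map_poly complex_of_real (\<Prod>e\<leftarrow>map Re as. [:- e, 1:])"
    by (induction as) (auto simp: hom_distribs)
  finally have "map_poly complex_of_real (char_poly G)
      = map_poly complex_of_real (\<Prod>e\<leftarrow>map Re as. [:- e, 1:])"
    using of_real_hom.char_poly_hom[OF G] by metis
  then have "char_poly G = (\<Prod>e\<leftarrow>map Re as. [:- e, 1:])"
    by (rule mp.injectivity)
  with that[of "map Re as"] as show thesis by simp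
qed

lemma proots_prod_linear: "proots (\<Prod>e\<leftarrow>es. [:- e, 1:]) = mset (es :: 'a :: idom list)"
proof -
  have "(\<Prod>e\<leftarrow>es. [:- e, 1:]) \<noteq> 0" for es :: "'a list"
    by (induction es) (auto simp del: mult_pCons_left)
  then show ?thesis
    by (induction es) (auto simp: proots_mult simp del: mult_pCons_left)
qed

text \<open>Any enumeration \<open>es\<close> of the roots may be chosen; the min-max principle uses the non-increasing
  one.\<close>

lemma real_symmetric_char_poly_roots:
  fixes G :: "real mat"
  assumes "G \<in> carrier_mat n n" and "G\<^sup>T = G" and "mset es = proots (char_poly G)"
  shows "char_poly G = (\<Prod>e\<leftarrow>es. [:- e, 1:])" and "length es = n"
proof -
  obtain fs where fs: "char_poly G = (\<Prod>e\<leftarrow>fs. [:- e, 1:])" "length fs = n"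
    using real_symmetric_char_poly_splits[OF assms(1,2)] .
  then have eq: "mset es = mset fs"
    using assms(3) proots_prod_linear[of fs] by simp
  show "length es = n"
    using eq fs(2) by (metis size_mset)
  have "mset (map (\<lambda>e. [:- e, 1:]) es) = mset (map (\<lambda>e. [:- e, 1:]) fs)"
    using eq by simp
  then show "char_poly G = (\<Prod>e\<leftarrow>es. [:- e, 1:])"
    unfolding fs(1) by (metis prod_mset_prod_list)
qed

text \<open>If \<open>v\<close> is not the first unit vector \<open>e\<close>, the Householder reflection along \<open>u = v - e\<close>
  exchanges \<open>e\<close> and \<open>v\<close>. Its usual form \<open>1 - 2 u u\<^sup>T / (u \<bullet> u)\<close> simplifies because
  \<open>u \<bullet> u = 2 (1 - v\<^sub>0)\<close> for a unit vector \<open>v\<close>.\<close>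

lemma orthogonal_matrix_with_first_column:
  assumes v: "v \<in> carrier_vec (Suc n)" "v \<bullet> v = (1::real)"
  obtains W where "W \<in> carrier_mat (Suc n) (Suc n)" "orthonormal_cols W" "col W 0 = v"
proof (cases "v $ 0 = 1")
  case True
  have "v \<bullet> v = (v $ 0)\<^sup>2 + (\<Sum>i<n. (v $ Suc i)\<^sup>2)"
    unfolding scalar_prod_self_eq_sum[OF v(1)] by (rule sum.lessThan_Suc_shift)
  then have "(\<Sum>i<n. (v $ Suc i)\<^sup>2) = 0"
    using True v by simp
  then have "\<forall>i<n. v $ Suc i = 0"
    by (subst (asm) sum_nonneg_eq_0_iff) auto
  then have "v = unit_vec (Suc n) 0"
    using True v by (intro eq_vecI) (auto simp: unit_vec_def less_Suc_eq_0_disj)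
  then show thesis
    using that[of "1\<^sub>m (Suc n)"] by (simp add: orthonormal_cols_def)
next
  case False
  define N where "N = Suc n"
  define u where "u = v - unit_vec N 0"
  define c where "c = 1 - v $ 0"
  define W where "W = mat N N (\<lambda>(i, j). (if i = j then 1 else 0) - u $ i * u $ j / c)"
  have u: "u \<in> carrier_vec N" using v by (simp add: u_def N_def)
  have W: "W \<in> carrier_mat N N" by (simp add: W_def)
  have c: "c \<noteq> 0" using False by (simp add: c_def)
  have "u \<bullet> u = v \<bullet> v - v \<bullet> unit_vec N 0 - (unit_vec N 0 \<bullet> v - unit_vec N 0 \<bullet> unit_vec N 0)"
    using v unfolding u_def N_def
    by (simp add: minus_scalar_prod_distrib[of _ "Suc n"] scalar_prod_minus_distrib[of _ "Suc n"])
  then have uu: "u \<bullet> u = 2 * c"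
    using v by (simp add: c_def N_def)
  have "W\<^sup>T * W = 1\<^sub>m N"
  proof (rule eq_matI)
    fix i j assume "i < dim_row (1\<^sub>m N :: real mat)" "j < dim_col (1\<^sub>m N :: real mat)"
    then have i: "i < N" and j: "j < N" by auto
    have "(W\<^sup>T * W) $$ (i, j) = (\<Sum>a = 0..<N. W $$ (a, i) * W $$ (a, j))"
      using i j W by (simp add: scalar_prod_def)
    also have "\<dots> = (\<Sum>a = 0..<N. (if a = i then (if a = j then 1 else 0) else 0)
        - (if a = i then u $ a * u $ j / c else 0) - (if a = j then u $ i * u $ a / c else 0)
        + (u $ i * u $ j / c\<^sup>2) * (u $ a * u $ a))"
      using i j by (intro sum.cong) (auto simp: W_def algebra_simps power2_eq_square)
    also have "\<dots> = (if i = j then 1 else 0) - u $ i * u $ j / c - u $ i * u $ j / c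
        + (u $ i * u $ j / c\<^sup>2) * (u \<bullet> u)"
      using i j u by (simp add: sum.distrib sum_subtractf sum_distrib_left[symmetric]
          sum_divide_distrib[symmetric] scalar_prod_def)
    also have "\<dots> = (if i = j then 1 else 0)"
      using c unfolding uu by (simp add: field_simps power2_eq_square)
    finally show "(W\<^sup>T * W) $$ (i, j) = 1\<^sub>m N $$ (i, j)"
      using i j by simp
  qed (use W in auto)
  then have "orthonormal_cols W"
    using W by (simp add: orthonormal_cols_def)
  moreover have "col W 0 = v"
  proof (rule eq_vecI)
    fix i assume "i < dim_vec v"
    then have i: "i < N" using v by (simp add: N_def)
    have "u $ 0 = - c" using v by (simp add: u_def N_def c_def)
    then have "col W 0 $ i = (if i = 0 then 1 else 0) + u $ i"
      using i c by (simp add: W_def N_def)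
    then show "col W 0 $ i = v $ i"
      using i v by (simp add: u_def N_def unit_vec_def)
  qed (use v in \<open>simp add: W_def N_def\<close>)
  ultimately show thesis
    using that W by (simp add: N_def)
qed

text \<open>Induction on the list of eigenvalues. Take a unit eigenvector for the first one, \<open>e\<close>, and an
  orthogonal matrix \<open>W\<close> having it as first column. The first column of \<open>W\<^sup>T G W\<close> is then \<open>e\<close> times the first
  unit vector and, by symmetry, so is the first row. The remaining block is symmetric, and
  cancelling the factor of \<open>e\<close> shows that its characteristic polynomial has the remaining list as
  its roots. As the list is followed from its head, the diagonal shows the eigenvalues in the given
  order.\<close>

lemma real_symmetric_diagonalization:
  fixes G :: "real mat"
  assumes "G \<in> carrier_mat n n" and "G\<^sup>T = G" and "char_poly G = (\<Prod>e\<leftarrow>es. [:- e, 1:])"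
    and "length es = n"
  shows "\<exists>W. W \<in> carrier_mat n n \<and> orthonormal_cols W \<and> W\<^sup>T * G * W = mat_diag n (\<lambda>i. es ! i)"
  using assms
proof (induction es arbitrary: n G)
  case Nil
  then show ?case
    by (intro exI[of _ "1\<^sub>m 0"]) (auto simp: orthonormal_cols_def mat_diag_def)
next
  case (Cons e es N)
  define n where "n = length es"
  have N: "N = Suc n" using Cons.prems by (simp add: n_def)
  note G = Cons.prems(1)[unfolded N] and sym = Cons.prems(2)
  have "eigenvalue G e"
    unfolding eigenvalue_root_char_poly[OF G] Cons.prems(3) by (simp add: poly_prod_list)
  then obtain v0 where v0: "v0 \<in> carrier_vec (Suc n)" "v0 \<noteq> 0\<^sub>v (Suc n)" "G *\<^sub>v v0 = e \<cdot>\<^sub>v v0"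
    using G unfolding eigenvalue_def eigenvector_def by auto
  define v where "v = (1 / vec_norm2 v0) \<cdot>\<^sub>v v0"
  have pos: "0 < v0 \<bullet> v0"
    using v0 by (intro scalar_prod_self_pos)
  have v: "v \<in> carrier_vec (Suc n)" "v \<bullet> v = 1" "G *\<^sub>v v = e \<cdot>\<^sub>v v"
    using v0 pos G vec_norm2_power2[of v0]
    by (auto simp: v_def mult_mat_vec smult_smult_assoc mult.commute power2_eq_square field_simps)
  obtain W where W: "W \<in> carrier_mat (Suc n) (Suc n)" "orthonormal_cols W" "col W 0 = v"
    using orthogonal_matrix_with_first_column[OF v(1,2)] .
  have WW: "W\<^sup>T * W = 1\<^sub>m (Suc n)" "W * W\<^sup>T = 1\<^sub>m (Suc n)"
    using W square_orthonormal_cols_transpose[OF W(1,2)] by (auto simp: orthonormal_cols_def)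
  define B where "B = W\<^sup>T * G * W"
  have B: "B \<in> carrier_mat (Suc n) (Suc n)" using W G by (simp add: B_def)
  have symB: "B\<^sup>T = B"
    using W G sym unfolding B_def
    by (simp add: transpose_mult[of _ "Suc n" "Suc n" _ "Suc n"]
        assoc_mult_mat[of _ "Suc n" "Suc n" _ "Suc n" _ "Suc n"])
  have "similar_mat B G"
    unfolding similar_mat_def similar_mat_wit_def
    by (rule exI[of _ "W\<^sup>T"], rule exI[of _ W]) (use W G WW B in \<open>auto simp: Let_def B_def\<close>)
  then have cpB: "char_poly B = char_poly G"
    by (rule char_poly_similar)
  have col0: "B $$ (i, 0) = (if i = 0 then e else 0)" if i: "i < Suc n" for i
  proof -
    have "col B 0 = (W\<^sup>T * G) *\<^sub>v col W 0"
      using W G unfolding B_def by (intro col_mult2) auto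
    also have "\<dots> = W\<^sup>T *\<^sub>v (G *\<^sub>v v)"
      unfolding W(3) using W G v by (intro assoc_mult_mat_vec) auto
    also have "\<dots> = e \<cdot>\<^sub>v (W\<^sup>T *\<^sub>v col W 0)"
      unfolding v(3) W(3) using W v by (intro mult_mat_vec) auto
    also have "W\<^sup>T *\<^sub>v col W 0 = col (W\<^sup>T * W) 0"
      using W by (intro col_mult2[symmetric]) auto
    finally have "col B 0 $ i = (if i = 0 then e else 0)"
      unfolding WW using i by simp
    then show ?thesis using i B by simp
  qed
  define B2 where "B2 = mat n n (\<lambda>(i, j). B $$ (Suc i, Suc j))"
  define E where "E = mat 1 1 (\<lambda>_. e)"
  have B2: "B2 \<in> carrier_mat n n" and E: "E \<in> carrier_mat 1 1" by (auto simp: B2_def E_def)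
  have row0: "B $$ (0, j) = (if j = 0 then e else 0)" if "j < Suc n" for j
    using arg_cong[OF symB, of "\<lambda>X. X $$ (j, 0)"] col0[OF that] that B by simp
  have block: "B = four_block_mat E (0\<^sub>m 1 n) (0\<^sub>m n 1) B2"
  proof (rule eq_matI)
    fix i j assume "i < dim_row (four_block_mat E (0\<^sub>m 1 n) (0\<^sub>m n 1) B2)"
      and "j < dim_col (four_block_mat E (0\<^sub>m 1 n) (0\<^sub>m n 1) B2)"
    then have "i < Suc n" "j < Suc n" using B2 E by auto
    then show "B $$ (i, j) = four_block_mat E (0\<^sub>m 1 n) (0\<^sub>m n 1) B2 $$ (i, j)"
      using B B2 E col0 row0 by (cases i; cases j) (auto simp: E_def B2_def)
  qed (use B B2 E in auto)
  have "char_poly B = char_poly E * char_poly B2"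
    unfolding block by (rule char_poly_four_block_zeros_col) (use B2 E in auto)
  also have "char_poly E = [:- e, 1:]"
    using char_poly_upper_triangular[OF E] by (auto simp: E_def diag_mat_def upper_triangular_def)
  finally have "[:- e, 1:] * char_poly B2 = [:- e, 1:] * (\<Prod>e\<leftarrow>es. [:- e, 1:])"
    using cpB Cons.prems(3) by simp
  then have "char_poly B2 = (\<Prod>e\<leftarrow>es. [:- e, 1:])"
    by (subst (asm) mult_cancel_left) auto
  moreover have "B2\<^sup>T = B2"
  proof (rule eq_matI)
    fix i j assume "i < dim_row B2" "j < dim_col B2"
    then show "B2\<^sup>T $$ (i, j) = B2 $$ (i, j)"
      using arg_cong[OF symB, of "\<lambda>X. X $$ (Suc i, Suc j)"] B by (simp add: B2_def)
  qed (use B2 in auto)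
  ultimately obtain X where X: "X \<in> carrier_mat n n" "orthonormal_cols X"
    "X\<^sup>T * B2 * X = mat_diag n (\<lambda>i. es ! i)"
    using Cons.IH[OF B2] n_def by auto
  \<comment> \<open>The diagonalization of the lower block, extended by the identity on the first coordinate.\<close>
  define Y where "Y = four_block_mat (1\<^sub>m 1) (0\<^sub>m 1 n) (0\<^sub>m n 1) X"
  have Y: "Y \<in> carrier_mat (Suc n) (Suc n)"
    using X by (auto simp: Y_def)
  have YT: "Y\<^sup>T = four_block_mat (1\<^sub>m 1) (0\<^sub>m 1 n) (0\<^sub>m n 1) X\<^sup>T"
    unfolding Y_def using X by (subst transpose_four_block_mat[of _ 1 1 _ n _ n]) auto
  have "Y\<^sup>T * Y = four_block_mat (1\<^sub>m 1) (0\<^sub>m 1 n) (0\<^sub>m n 1) (1\<^sub>m n)"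
    unfolding YT unfolding Y_def using X
    by (subst mult_four_block_mat[of _ 1 1 _ n _ n _ _ 1 _ n])
      (auto simp: orthonormal_cols_def)
  then have oY: "orthonormal_cols Y"
    using Y by (simp add: orthonormal_cols_def)
  have "Y\<^sup>T * B * Y = four_block_mat E (0\<^sub>m 1 n) (0\<^sub>m n 1) (X\<^sup>T * B2 * X)"
    unfolding YT block unfolding Y_def using X E B2
    by (simp add: mult_four_block_mat[of _ 1 1 _ n _ n _ _ 1 _ n])
  also have "\<dots> = mat_diag (Suc n) (\<lambda>i. (e # es) ! i)"
    unfolding X(3) by (rule eq_matI) (auto simp: mat_diag_def E_def nth_Cons')
  finally have "Y\<^sup>T * B * Y = mat_diag (Suc n) (\<lambda>i. (e # es) ! i)" .
  moreover have "(W * Y)\<^sup>T * G * (W * Y) = Y\<^sup>T * B * Y"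
    unfolding B_def using W Y G
    by (simp add: transpose_mult[of _ "Suc n" "Suc n" _ "Suc n"]
        assoc_mult_mat[of _ "Suc n" "Suc n" _ "Suc n" _ "Suc n"])
  moreover have "orthonormal_cols (W * Y)"
    by (rule orthonormal_cols_mult[OF W(1,2) Y oY])
  ultimately show ?case
    using W Y unfolding N by (intro exI[of _ "W * Y"]) auto
qed

section \<open>The min-max principle\<close>

text \<open>Padding with zero rows makes the matrix square and singular.\<close>

lemma wide_matrix_has_kernel_vector:
  fixes A :: "'a :: field mat"
  assumes A: "A \<in> carrier_mat r c" and "r < c"
  obtains v where "v \<in> carrier_vec c" "v \<noteq> 0\<^sub>v c" "A *\<^sub>v v = 0\<^sub>v r"
proof -
  define B where "B = mat c c (\<lambda>(i, j). if i < r then A $$ (i, j) else 0)"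
  have B: "B \<in> carrier_mat c c" by (simp add: B_def)
  have "B = mat\<^sub>r c c (\<lambda>i. if i = r then 0\<^sub>v c else row B i)"
    using \<open>r < c\<close> by (intro eq_matI) (auto simp: B_def)
  then have "det B = 0"
    using det_row_0[of r c "row B"] \<open>r < c\<close> B by auto
  then obtain v where v: "v \<in> carrier_vec c" "v \<noteq> 0\<^sub>v c" "B *\<^sub>v v = 0\<^sub>v c"
    using det_0_iff_vec_prod_zero[OF B] by blast
  have "A *\<^sub>v v = 0\<^sub>v r"
  proof (rule eq_vecI)
    fix i assume i: "i < dim_vec (0\<^sub>v r :: 'a vec)"
    have "row A i = row B i"
      using i A \<open>r < c\<close> by (intro eq_vecI) (auto simp: B_def)
    then show "(A *\<^sub>v v) $ i = 0\<^sub>v r $ i"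
      using arg_cong[OF v(3), of "\<lambda>w. w $ i"] i A B \<open>r < c\<close> by simp
  qed (use A in simp)
  with v that show thesis by blast
qed

lemma left_inverse_imp_tall:
  fixes X :: "'a :: field mat"
  assumes X: "X \<in> carrier_mat n m" and Y: "Y \<in> carrier_mat m n" and XY: "X * Y = 1\<^sub>m n"
  shows "n \<le> m"
proof (rule ccontr)
  assume "\<not> n \<le> m"
  then obtain v where v: "v \<in> carrier_vec n" "v \<noteq> 0\<^sub>v n" "Y *\<^sub>v v = 0\<^sub>v m"
    using wide_matrix_has_kernel_vector[OF Y] by auto
  have "v = (X * Y) *\<^sub>v v" using XY v by simp
  also have "\<dots> = X *\<^sub>v (Y *\<^sub>v v)" using X Y v by (intro assoc_mult_mat_vec)
  also have "\<dots> = 0\<^sub>v n" unfolding v(3) using X by (intro eq_vecI) auto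
  finally show False using v by simp
qed

text \<open>The half of the Courant-Fischer theorem that bounds eigenvalues from below: if the quadratic form
  of \<open>G\<close> is at least \<open>c\<close> on the unit sphere of the range of \<open>X\<close>, a subspace of dimension \<open>k+1\<close>, then
  so is the eigenvalue with index \<open>k\<close>. Orthogonality to the first \<open>k\<close> vectors of an
  orthonormal eigenbasis, in the order of \<open>es\<close>, is a system of
  \<open>k\<close> equations in \<open>k+1\<close> unknowns, so the subspace contains a nonzero \<open>x\<close> satisfying it; the form at
  \<open>x\<close> involves only eigenvalues from index \<open>k\<close> on and is therefore at most \<open>es ! k * (x \<bullet> x)\<close>.\<close>

lemma min_max_lower_bound:
  fixes G :: "real mat"
  assumes G: "G \<in> carrier_mat n n" and sym: "G\<^sup>T = G"
    and es: "mset es = proots (char_poly G)" "sorted (rev es)"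
    and X: "X \<in> carrier_mat n (Suc k)" "orthonormal_cols X"
    and lower: "\<And>y. y \<in> carrier_vec (Suc k) \<Longrightarrow> c * (y \<bullet> y) \<le> (X *\<^sub>v y) \<bullet> (G *\<^sub>v (X *\<^sub>v y))"
  shows "c \<le> es ! k"
proof -
  note split = real_symmetric_char_poly_roots[OF G sym es(1)]
  obtain W where W: "W \<in> carrier_mat n n" "orthonormal_cols W"
    and diag: "W\<^sup>T * G * W = mat_diag n (\<lambda>i. es ! i)"
    using real_symmetric_diagonalization[OF G sym split] by blast
  have "Suc k \<le> n"
    using X by (intro left_inverse_imp_tall[of "X\<^sup>T" _ _ X]) (auto simp: orthonormal_cols_def)
  \<comment> \<open>\<open>T\<close> collects the inner products of the columns of \<open>X\<close> with the first \<open>k\<close> eigenvectors.\<close>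
  define T where "T = mat k (Suc k) (\<lambda>(i, j). (W\<^sup>T * X) $$ (i, j))"
  have "T \<in> carrier_mat k (Suc k)" by (simp add: T_def)
  then obtain y where y: "y \<in> carrier_vec (Suc k)" "y \<noteq> 0\<^sub>v (Suc k)" "T *\<^sub>v y = 0\<^sub>v k"
    using wide_matrix_has_kernel_vector[of T k "Suc k"] by blast
  define x where "x = X *\<^sub>v y"
  \<comment> \<open>The coordinates of \<open>x\<close> in the eigenbasis; the first \<open>k\<close> of them vanish.\<close>
  define z where "z = W\<^sup>T *\<^sub>v x"
  have x: "x \<in> carrier_vec n" and z: "z \<in> carrier_vec n"
    using X W y by (auto simp: x_def z_def)
  have z0: "z $ i = 0" if i: "i < k" for i
  proof -
    have "z = (W\<^sup>T * X) *\<^sub>v y"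
      unfolding z_def x_def using W X y by (intro assoc_mult_mat_vec[symmetric]) auto
    moreover have "row (W\<^sup>T * X) i = row T i"
      using i W X \<open>Suc k \<le> n\<close> by (intro eq_vecI) (auto simp: T_def)
    ultimately have "z $ i = (T *\<^sub>v y) $ i"
      using i W \<open>Suc k \<le> n\<close> by (simp add: T_def)
    then show ?thesis using y(3) i by simp
  qed
  have xWz: "x = W *\<^sub>v z"
  proof -
    have "W *\<^sub>v z = (W * W\<^sup>T) *\<^sub>v x"
      unfolding z_def using W x by (intro assoc_mult_mat_vec[symmetric]) auto
    then show ?thesis
      using square_orthonormal_cols_transpose(1)[OF W] x by simp
  qed
  have zz: "z \<bullet> z = y \<bullet> y"
    using orthonormal_cols_scalar_prod[OF W z z] orthonormal_cols_scalar_prod[OF X y(1) y(1)]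
    unfolding xWz[symmetric] x_def[symmetric] by simp
  have "c * (y \<bullet> y) \<le> x \<bullet> (G *\<^sub>v x)"
    using lower[OF y(1)] by (simp add: x_def)
  also have "\<dots> = z \<bullet> (W\<^sup>T *\<^sub>v (G *\<^sub>v x))"
  proof -
    have "G *\<^sub>v x \<in> carrier_vec n" using G x by simp
    then show ?thesis
      using transpose_vec_mult_scalar[of "W\<^sup>T" n n "G *\<^sub>v x" z] W z xWz by simp
  qed
  also have "W\<^sup>T *\<^sub>v (G *\<^sub>v x) = (W\<^sup>T * G * W) *\<^sub>v z"
    unfolding xWz using W G z by (simp add: assoc_mult_mat_vec[of _ n n _ n])
  also have "z \<bullet> \<dots> = (\<Sum>i<n. es ! i * (z $ i)\<^sup>2)"
  proof -
    have "(mat_diag n (\<lambda>i. es ! i) *\<^sub>v z) $ i = es ! i * z $ i" if "i < n" for i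
      using that z by (simp add: mat_diag_def scalar_prod_def if_distrib[of "\<lambda>x. x * _"] cong: if_cong)
    then show ?thesis
      unfolding diag using z
      by (simp add: scalar_prod_def mat_diag_def lessThan_atLeast0 power2_eq_square mult_ac)
  qed
  also have "\<dots> \<le> (\<Sum>i<n. es ! k * (z $ i)\<^sup>2)"
  proof (rule sum_mono)
    fix i assume i: "i \<in> {..<n}"
    show "es ! i * (z $ i)\<^sup>2 \<le> es ! k * (z $ i)\<^sup>2"
    proof (cases "i < k")
      case False
      then have "es ! i \<le> es ! k"
        using sorted_rev_nth_mono[OF es(2), of k i] i split(2) by simp
      then show ?thesis by (intro mult_right_mono) auto
    qed (simp add: z0)
  qed
  also have "\<dots> = es ! k * (y \<bullet> y)"
    unfolding zz[symmetric] scalar_prod_self_eq_sum[OF z] by (rule sum_distrib_left[symmetric])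
  finally show ?thesis
    using scalar_prod_self_pos[OF y(1,2)] by simp
qed

text \<open>The min-max bound for \<open>A\<^sup>T A\<close>, whose quadratic form is the squared length of \<open>A x\<close>. Singular
  values count from 1, whereas the eigenvalue list is indexed from 0.\<close>

lemma singular_value_lower_bound:
  assumes A: "A \<in> carrier_mat m n" and k: "k < min m n"
    and X: "X \<in> carrier_mat n (Suc k)" "orthonormal_cols X" and "0 \<le> c"
    and lower: "\<And>y. y \<in> carrier_vec (Suc k) \<Longrightarrow> c * vec_norm2 y \<le> vec_norm2 (A *\<^sub>v (X *\<^sub>v y))"
  shows "c \<le> singular_value A (k + 1)"
proof -
  define es where "es = rev (sorted_list_of_multiset (proots (char_poly (A\<^sup>T * A))))"
  have G: "A\<^sup>T * A \<in> carrier_mat n n" and sym: "(A\<^sup>T * A)\<^sup>T = A\<^sup>T * A"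
    using A by (auto simp: transpose_mult[of _ n m _ n])
  have es: "mset es = proots (char_poly (A\<^sup>T * A))" "sorted (rev es)"
    by (auto simp: es_def)
  have "c\<^sup>2 \<le> es ! k"
  proof (rule min_max_lower_bound[OF G sym es X])
    fix y :: "real vec" assume y: "y \<in> carrier_vec (Suc k)"
    define x where "x = X *\<^sub>v y"
    have x: "x \<in> carrier_vec n" using X y by (simp add: x_def)
    have "c\<^sup>2 * (y \<bullet> y) = (c * vec_norm2 y)\<^sup>2"
      by (simp add: power_mult_distrib vec_norm2_power2)
    also have "\<dots> \<le> (vec_norm2 (A *\<^sub>v x))\<^sup>2"
      using lower[OF y] \<open>0 \<le> c\<close> vec_norm2_nonneg by (intro power_mono) (auto simp: x_def)
    also have "\<dots> = (A *\<^sub>v x) \<bullet> (A *\<^sub>v x)"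
      by (rule vec_norm2_power2)
    also have "\<dots> = x \<bullet> (A\<^sup>T *\<^sub>v (A *\<^sub>v x))"
      using transpose_vec_mult_scalar[of "A\<^sup>T" n m "A *\<^sub>v x" x] A x by simp
    also have "A\<^sup>T *\<^sub>v (A *\<^sub>v x) = (A\<^sup>T * A) *\<^sub>v x"
      using A x by (intro assoc_mult_mat_vec[symmetric]) auto
    finally show "c\<^sup>2 * (y \<bullet> y) \<le> (X *\<^sub>v y) \<bullet> (A\<^sup>T * A *\<^sub>v (X *\<^sub>v y))"
      by (simp add: x_def)
  qed
  then have "c \<le> sqrt (es ! k)"
    by (rule real_le_rsqrt)
  moreover have "singular_value A (k + 1) = sqrt (es ! k)"
    using A k real_symmetric_char_poly_roots(2)[OF G sym es(1)]
    by (simp add: singular_value_def singular_values_def es_def)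
  ultimately show ?thesis by simp
qed

section \<open>Truncated singular value decompositions\<close>

lemma diagonal_mat_mult_vec_index:
  assumes "S \<in> carrier_mat r n" "diagonal_mat S" "y \<in> carrier_vec n" "i < r"
  shows "(S *\<^sub>v y) $ i = (if i < n then S $$ (i, i) * y $ i else (0 :: 'a :: comm_semiring_0))"
proof -
  have "(S *\<^sub>v y) $ i = (\<Sum>j = 0..<n. S $$ (i, j) * y $ j)"
    using assms by (simp add: scalar_prod_def)
  also have "\<dots> = (\<Sum>j = 0..<n. if j = i then S $$ (i, i) * y $ i else 0)"
    using assms by (intro sum.cong) (auto simp: diagonal_mat_def)
  also have "\<dots> = (if i < n then S $$ (i, i) * y $ i else 0)"
    by simp
  finally show ?thesis .
qed

lemma orthonormal_cols_leading_cols: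
  assumes V: "V \<in> carrier_mat n p" "orthonormal_cols V" and "l \<le> p"
  shows "leading_cols l V \<in> carrier_mat n l" "orthonormal_cols (leading_cols l V)"
proof -
  let ?X = "leading_cols l V"
  show X: "?X \<in> carrier_mat n l" using V by (simp add: leading_cols_def leading_block_def)
  have "?X\<^sup>T * ?X = 1\<^sub>m l"
  proof (rule eq_matI)
    fix i j assume "i < dim_row (1\<^sub>m l :: real mat)" "j < dim_col (1\<^sub>m l :: real mat)"
    then have ij: "i < l" "j < l" by auto
    have "col ?X a = col V a" if "a < l" for a
      using that V \<open>l \<le> p\<close> by (intro eq_vecI) (auto simp: leading_cols_def leading_block_def)
    then have "(?X\<^sup>T * ?X) $$ (i, j) = (V\<^sup>T * V) $$ (i, j)"
      using ij X V \<open>l \<le> p\<close> by simp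
    also have "\<dots> = 1\<^sub>m p $$ (i, j)"
      using V by (simp add: orthonormal_cols_def)
    finally show "(?X\<^sup>T * ?X) $$ (i, j) = 1\<^sub>m l $$ (i, j)"
      using ij \<open>l \<le> p\<close> by simp
  qed (use X in auto)
  then show "orthonormal_cols ?X" using X by (simp add: orthonormal_cols_def)
qed

text \<open>Truncation turned into zero-padding: products with \<open>leading_cols l V\<close> become products with \<open>V\<close>, to
  which orthogonality applies.\<close>

lemma leading_cols_mult_vec:
  assumes "V \<in> carrier_mat n p" "y \<in> carrier_vec l" "l \<le> p"
  shows "leading_cols l V *\<^sub>v y = V *\<^sub>v vec p (\<lambda>i. if i < l then y $ i else (0 :: 'a :: comm_semiring_0))"
proof (rule eq_vecI)
  fix i assume "i < dim_vec (V *\<^sub>v vec p (\<lambda>i. if i < l then y $ i else 0))"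
  then have i: "i < n" using assms by simp
  have "(\<Sum>j = 0..<p. V $$ (i, j) * (if j < l then y $ j else 0)) = (\<Sum>j = 0..<l. V $$ (i, j) * y $ j)"
    using assms by (intro sum.mono_neutral_cong_right) auto
  then show "(leading_cols l V *\<^sub>v y) $ i = (V *\<^sub>v vec p (\<lambda>i. if i < l then y $ i else 0)) $ i"
    using i assms by (simp add: scalar_prod_def leading_cols_def leading_block_def)
qed (use assms in \<open>simp add: leading_cols_def leading_block_def\<close>)

lemma svd_mult_vec:
  assumes "is_svd B U S V" "B \<in> carrier_mat r n" "x \<in> carrier_vec n"
  shows "B *\<^sub>v x = U *\<^sub>v (S *\<^sub>v (V\<^sup>T *\<^sub>v x))"
proof -
  have U: "U \<in> carrier_mat r r" and S: "S \<in> carrier_mat r n" and V: "V \<in> carrier_mat n n"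
    and B: "B = U * S * V\<^sup>T"
    using assms by (auto simp: is_svd_def)
  have "B *\<^sub>v x = (U * S) *\<^sub>v (V\<^sup>T *\<^sub>v x)"
    unfolding B using U S V assms(3) by (intro assoc_mult_mat_vec) auto
  also have "\<dots> = U *\<^sub>v (S *\<^sub>v (V\<^sup>T *\<^sub>v x))"
    using U S V assms(3) by (intro assoc_mult_mat_vec) auto
  finally show ?thesis .
qed

text \<open>On the span of the first \<open>k+1\<close> right singular vectors \<open>B\<close> only involves singular values with
  index at most \<open>k\<close>, and these are at least \<open>S $$ (k, k)\<close>. This span is the subspace to which the
  min-max principle is applied.\<close>

lemma svd_leading_cols_lower_bound:
  assumes svd: "is_svd B U S V" and B: "B \<in> carrier_mat r n" and k: "k < min r n"
    and y: "y \<in> carrier_vec (Suc k)"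
  shows "S $$ (k, k) * vec_norm2 y \<le> vec_norm2 (B *\<^sub>v (leading_cols (Suc k) V *\<^sub>v y))"
proof -
  have U: "U \<in> carrier_mat r r" "orthonormal_cols U" and S: "S \<in> carrier_mat r n" "diagonal_mat S"
    and V: "V \<in> carrier_mat n n" "orthonormal_cols V" and nonneg: "S $$ (k, k) \<ge> 0"
    and desc: "\<And>i. i \<le> k \<Longrightarrow> S $$ (k, k) \<le> S $$ (i, i)"
    using svd B k by (auto simp: is_svd_def)
  define p where "p = vec n (\<lambda>i. if i < Suc k then y $ i else 0)"
  have p: "p \<in> carrier_vec n" by (simp add: p_def)
  have "V\<^sup>T *\<^sub>v (leading_cols (Suc k) V *\<^sub>v y) = (V\<^sup>T * V) *\<^sub>v p"
    using V k y p
    by (subst leading_cols_mult_vec[of V n n]) (auto simp: p_def intro!: assoc_mult_mat_vec[symmetric])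
  also have "\<dots> = p"
    using V p by (simp add: orthonormal_cols_def)
  finally have "B *\<^sub>v (leading_cols (Suc k) V *\<^sub>v y) = U *\<^sub>v (S *\<^sub>v p)"
    using svd_mult_vec[OF svd B, of "leading_cols (Suc k) V *\<^sub>v y"]
      mult_mat_vec_carrier[OF orthonormal_cols_leading_cols(1)[OF V, of "Suc k"] y] k by simp
  then have norm: "vec_norm2 (B *\<^sub>v (leading_cols (Suc k) V *\<^sub>v y)) = vec_norm2 (S *\<^sub>v p)"
    using vec_norm2_orthonormal_cols[OF U, of "S *\<^sub>v p"] S p by simp
  have "(S $$ (k, k) * vec_norm2 y)\<^sup>2 = (\<Sum>i<Suc k. (S $$ (k, k) * y $ i)\<^sup>2)"
    by (simp only: power_mult_distrib vec_norm2_power2 scalar_prod_self_eq_sum[OF y] sum_distrib_left)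
  also have "\<dots> \<le> (\<Sum>i<Suc k. ((S *\<^sub>v p) $ i)\<^sup>2)"
  proof (rule sum_mono)
    fix i assume "i \<in> {..<Suc k}"
    then have i: "i \<le> k" by simp
    then have "(S *\<^sub>v p) $ i = S $$ (i, i) * y $ i"
      using diagonal_mat_mult_vec_index[OF S p, of i] k by (simp add: p_def)
    moreover have "(S $$ (k, k))\<^sup>2 \<le> (S $$ (i, i))\<^sup>2"
      using desc[OF i] nonneg by (intro power_mono)
    ultimately show "(S $$ (k, k) * y $ i)\<^sup>2 \<le> ((S *\<^sub>v p) $ i)\<^sup>2"
      by (simp add: power_mult_distrib mult_right_mono)
  qed
  also have "\<dots> \<le> (\<Sum>i<r. ((S *\<^sub>v p) $ i)\<^sup>2)"
    using k by (intro sum_mono2) auto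
  also have "\<dots> = (vec_norm2 (S *\<^sub>v p))\<^sup>2"
    unfolding vec_norm2_power2 using S p by (intro scalar_prod_self_eq_sum[symmetric]) simp
  finally show ?thesis
    unfolding norm by (rule power2_le_imp_le) (rule vec_norm2_nonneg)
qed

text \<open>In the coordinates \<open>y = V\<^sup>T x\<close> truncation cancels the entries with index below \<open>k\<close> of \<open>S y\<close> and
  leaves the others, each scaled by at most \<open>S $$ (k, k)\<close>; \<open>U\<close> and \<open>V\<close> preserve length.\<close>

lemma svd_truncation_error:
  assumes svd: "is_svd B U S V" and B: "B \<in> carrier_mat r n" and k: "k < min r n"
    and x: "x \<in> carrier_vec n"
  shows "vec_norm2 (B *\<^sub>v x -
      leading_cols k U *\<^sub>v (leading_block k k S *\<^sub>v ((leading_cols k V)\<^sup>T *\<^sub>v x)))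
    \<le> S $$ (k, k) * vec_norm2 x"
proof -
  have U: "U \<in> carrier_mat r r" "orthonormal_cols U" and S: "S \<in> carrier_mat r n" "diagonal_mat S"
    and V: "V \<in> carrier_mat n n" "orthonormal_cols V"
    and nonneg: "\<And>i. i < min r n \<Longrightarrow> S $$ (i, i) \<ge> 0"
    and desc: "\<And>i. k \<le> i \<Longrightarrow> i < min r n \<Longrightarrow> S $$ (i, i) \<le> S $$ (k, k)"
    using svd B by (auto simp: is_svd_def)
  define y where "y = V\<^sup>T *\<^sub>v x"
  have y: "y \<in> carrier_vec n" using V x by (simp add: y_def)
  define t where "t = leading_block k k S *\<^sub>v ((leading_cols k V)\<^sup>T *\<^sub>v x)"
  have t: "t \<in> carrier_vec k" by (intro carrier_vecI) (simp add: t_def leading_block_def)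
  have t_nth: "t $ i = S $$ (i, i) * y $ i" if i: "i < k" for i
  proof -
    have "leading_block k k S \<in> carrier_mat k k" "diagonal_mat (leading_block k k S)"
      using S k by (auto simp: leading_block_def diagonal_mat_def)
    moreover have "(leading_cols k V)\<^sup>T *\<^sub>v x \<in> carrier_vec k"
      by (intro carrier_vecI) (simp add: leading_cols_def leading_block_def)
    ultimately have "t $ i = leading_block k k S $$ (i, i) * ((leading_cols k V)\<^sup>T *\<^sub>v x) $ i"
      using diagonal_mat_mult_vec_index[of "leading_block k k S" k k _ i] i unfolding t_def by simp
    moreover have "col (leading_cols k V) i = col V i"
      using i k V by (intro eq_vecI) (auto simp: leading_cols_def leading_block_def)
    ultimately show ?thesis
      using i k V by (simp add: y_def leading_block_def leading_cols_def)
  qed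
  define p where "p = vec r (\<lambda>i. if i < k then t $ i else 0)"
  define e where "e = S *\<^sub>v y - p"
  have Sy: "S *\<^sub>v y \<in> carrier_vec r" and p: "p \<in> carrier_vec r" and e: "e \<in> carrier_vec r"
    using S y by (auto simp: p_def e_def)
  have e_nth: "e $ i = (if k \<le> i \<and> i < n then S $$ (i, i) * y $ i else 0)" if "i < r" for i
    using that k diagonal_mat_mult_vec_index[OF S y that] t_nth[of i] S
    by (simp add: e_def p_def)
  have "leading_cols k U *\<^sub>v t = U *\<^sub>v p"
    using leading_cols_mult_vec[OF U(1) t] k by (simp add: p_def)
  then have "B *\<^sub>v x - leading_cols k U *\<^sub>v t = U *\<^sub>v e"
    using svd_mult_vec[OF svd B x] mult_minus_distrib_mat_vec[OF U(1) Sy p]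
    by (simp add: y_def e_def)
  then have norm: "vec_norm2 (B *\<^sub>v x - leading_cols k U *\<^sub>v t) = vec_norm2 e"
    using vec_norm2_orthonormal_cols[OF U e] by simp
  have normy: "vec_norm2 y = vec_norm2 x"
    unfolding y_def using V x square_orthonormal_cols_transpose(2)[OF V]
    by (intro vec_norm2_orthonormal_cols) auto
  have "(vec_norm2 e)\<^sup>2 = (\<Sum>i<r. (e $ i)\<^sup>2)"
    unfolding vec_norm2_power2 using e by (rule scalar_prod_self_eq_sum)
  also have "\<dots> = (\<Sum>i\<in>{..<r} \<inter> {..<n}. (e $ i)\<^sup>2)"
    by (intro sum.mono_neutral_right) (auto simp: e_nth)
  also have "\<dots> \<le> (\<Sum>i\<in>{..<r} \<inter> {..<n}. (S $$ (k, k) * y $ i)\<^sup>2)"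
  proof (rule sum_mono)
    fix i assume i: "i \<in> {..<r} \<inter> {..<n}"
    show "(e $ i)\<^sup>2 \<le> (S $$ (k, k) * y $ i)\<^sup>2"
    proof (cases "k \<le> i")
      case True
      have "(S $$ (i, i))\<^sup>2 \<le> (S $$ (k, k))\<^sup>2"
        using desc[OF True] nonneg[of i] i by (intro power_mono) auto
      then show ?thesis
        using i True by (simp add: e_nth power_mult_distrib mult_right_mono)
    qed (use i e_nth in simp)
  qed
  also have "\<dots> \<le> (\<Sum>i<n. (S $$ (k, k) * y $ i)\<^sup>2)"
    by (intro sum_mono2) auto
  also have "\<dots> = (S $$ (k, k) * vec_norm2 y)\<^sup>2"
    by (simp only: power_mult_distrib vec_norm2_power2 scalar_prod_self_eq_sum[OF y] sum_distrib_left)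
  finally have "vec_norm2 e \<le> S $$ (k, k) * vec_norm2 y"
    by (rule power2_le_imp_le) (use nonneg[OF k] vec_norm2_nonneg in auto)
  then show ?thesis
    using norm normy by (simp add: t_def)
qed

text \<open>Multiplication by \<open>Q\<^sup>T\<close> never lengthens a vector, so whatever \<open>Q\<^sup>T A\<close> stretches by a factor \<open>c\<close> on a
  subspace, \<open>A\<close> stretches by at least \<open>c\<close>. The min-max principle turns this into an
  inequality of singular values.\<close>

lemma compressed_singular_value_le:
  assumes Q: "Q \<in> carrier_mat m r" "orthonormal_cols Q" and A: "A \<in> carrier_mat m n"
    and svd: "is_svd (Q\<^sup>T * A) U S V" and k: "k < min r n"
  shows "S $$ (k, k) \<le> singular_value A (k + 1)"
proof (rule singular_value_lower_bound[OF A])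
  have B: "Q\<^sup>T * A \<in> carrier_mat r n" using Q A by simp
  have V: "V \<in> carrier_mat n n" "orthonormal_cols V" and nonneg: "S $$ (k, k) \<ge> 0"
    using svd k carrier_matD[OF B] unfolding is_svd_def by auto
  have "r \<le> m"
    using Q by (intro left_inverse_imp_tall[of "Q\<^sup>T" r m Q]) (auto simp: orthonormal_cols_def)
  then show "k < min m n" using k by simp
  show X: "leading_cols (Suc k) V \<in> carrier_mat n (Suc k)" "orthonormal_cols (leading_cols (Suc k) V)"
    using orthonormal_cols_leading_cols[OF V, of "Suc k"] k by auto
  show "0 \<le> S $$ (k, k)" by (rule nonneg)
  fix y :: "real vec" assume y: "y \<in> carrier_vec (Suc k)"
  define x where "x = leading_cols (Suc k) V *\<^sub>v y"
  have x: "x \<in> carrier_vec n" using X y by (simp add: x_def)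
  have "S $$ (k, k) * vec_norm2 y \<le> vec_norm2 (Q\<^sup>T * A *\<^sub>v x)"
    unfolding x_def by (rule svd_leading_cols_lower_bound[OF svd B k y])
  also have "Q\<^sup>T * A *\<^sub>v x = Q\<^sup>T *\<^sub>v (A *\<^sub>v x)"
    using Q A x by (intro assoc_mult_mat_vec) auto
  also have "vec_norm2 \<dots> \<le> vec_norm2 (A *\<^sub>v x)"
    using Q A x by (intro vec_norm2_transpose_orthonormal_le) auto
  finally show "S $$ (k, k) * vec_norm2 y \<le> vec_norm2 (A *\<^sub>v (leading_cols (Suc k) V *\<^sub>v y))"
    by (simp add: x_def)
qed

section \<open>The error of SPC-SVD\<close>

text \<open>The projection \<open>Q Q\<^sup>T\<close> fixes the range of \<open>Q\<close>, since \<open>Q\<^sup>T Q = 1\<close>; so the residual does not see a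
  summand from that range. In the theorem, \<open>Q q\<close> is the value of \<open>A\<^sub>c M\<close> and \<open>w\<close> that of \<open>E\<^sub>I\<close>.\<close>

lemma projection_residual_add_range:
  assumes Q: "Q \<in> carrier_mat m r" "orthonormal_cols Q"
    and q: "q \<in> carrier_vec r" and w: "w \<in> carrier_vec m"
  shows "(Q *\<^sub>v q + w) - Q *\<^sub>v (Q\<^sup>T *\<^sub>v (Q *\<^sub>v q + w)) = w - Q *\<^sub>v (Q\<^sup>T *\<^sub>v w)"
proof -
  have "Q\<^sup>T *\<^sub>v (Q *\<^sub>v q) = (Q\<^sup>T * Q) *\<^sub>v q"
    using Q q by (intro assoc_mult_mat_vec[symmetric]) auto
  then have "Q\<^sup>T *\<^sub>v (Q *\<^sub>v q + w) = q + Q\<^sup>T *\<^sub>v w"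
    using Q q w mult_add_distrib_mat_vec[of "Q\<^sup>T" r m "Q *\<^sub>v q" w]
    by (simp del: assoc_mult_mat_vec add: orthonormal_cols_def)
  then have "Q *\<^sub>v (Q\<^sup>T *\<^sub>v (Q *\<^sub>v q + w)) = Q *\<^sub>v q + Q *\<^sub>v (Q\<^sup>T *\<^sub>v w)"
    using Q q w by (simp add: mult_add_distrib_mat_vec[of _ m r])
  then show ?thesis
    using Q q w by (intro eq_vecI) auto
qed

theorem theorem3p2:
  fixes m n nc k :: nat
    and Af D Ac M EI Ahat :: "real mat"
  assumes "Af \<in> carrier_mat m n"
    and "D \<in> carrier_mat n nc"
    and "Ac = Af * D"
    and "vec_space.rank m Ac = nc"
    and "1 \<le> k" and "k < nc"
    and "M \<in> carrier_mat nc n"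
    and "EI \<in> carrier_mat m n"
    and "Af = Ac * M + EI"
    and "spc_svd Af D k Ahat"
  shows "spectral_norm (Af - Ahat) \<le> singular_value Af (k + 1) + spectral_norm EI"
proof -
  note Af = assms(1) and D = assms(2) and M = assms(7) and EI = assms(8)
  have Ac: "Ac \<in> carrier_mat m nc" using assms(3) Af D by simp
  obtain H Q R Rinv U S V where H: "H = Af\<^sup>T * Ac" and qr: "thin_qr Ac Q R"
    and Rinv: "Rinv \<in> carrier_mat nc nc" "inverts_mat R Rinv" "inverts_mat Rinv R"
    and svd0: "is_svd ((H * Rinv)\<^sup>T) U S V"
    and Ahat: "Ahat = Q * leading_cols k U * leading_block k k S * (leading_cols k V)\<^sup>T"
    using assms(10) Ac unfolding spc_svd_def assms(3)[symmetric] by auto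
  have Q: "Q \<in> carrier_mat m nc" "orthonormal_cols Q" and R: "R \<in> carrier_mat nc nc"
    and AcQR: "Ac = Q * R"
    using qr Ac by (auto simp: thin_qr_def)
  have RR: "R * Rinv = 1\<^sub>m nc" "Rinv * R = 1\<^sub>m nc"
    using Rinv R by (auto simp: inverts_mat_def)
  have "H * Rinv = Af\<^sup>T * (Q * (R * Rinv))"
    unfolding H AcQR using Af Q R Rinv
    by (simp add: assoc_mult_mat[of _ n m _ nc _ nc] assoc_mult_mat[of _ m nc _ nc _ nc])
  then have "H * Rinv = Af\<^sup>T * Q"
    using RR Q by simp
  then have "(H * Rinv)\<^sup>T = Q\<^sup>T * Af"
    using Af Q by (simp add: transpose_mult[of _ n m _ nc])
  with svd0 have svd: "is_svd (Q\<^sup>T * Af) U S V" by simp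
  have B: "Q\<^sup>T * Af \<in> carrier_mat nc n" using Q Af by simp
  have QQ: "Q\<^sup>T * Q = 1\<^sub>m nc" using Q by (simp add: orthonormal_cols_def)
  \<comment> \<open>\<open>A\<^sub>c = A\<^sub>f D\<close> has independent columns, hence so has \<open>D\<close>: a left inverse is \<open>Rinv Q\<^sup>T A\<^sub>f\<close>.\<close>
  have "nc \<le> n"
  proof (rule left_inverse_imp_tall)
    have "Rinv * (Q\<^sup>T * Af) * D = Rinv * (Q\<^sup>T * Ac)"
      unfolding assms(3) using Rinv Q Af D
      by (simp add: assoc_mult_mat[of _ nc nc _ n _ nc] assoc_mult_mat[of _ nc m _ n _ nc])
    also have "Q\<^sup>T * Ac = (Q\<^sup>T * Q) * R"
      unfolding AcQR using Q R by (intro assoc_mult_mat[symmetric]) auto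
    finally show "Rinv * (Q\<^sup>T * Af) * D = 1\<^sub>m nc"
      using RR R QQ by simp
    show "Rinv * (Q\<^sup>T * Af) \<in> carrier_mat nc n" using Rinv B by simp
  qed (rule D)
  then have k: "k < min nc n" using assms(6) by simp
  have U: "U \<in> carrier_mat nc nc" and V: "V \<in> carrier_mat n n"
    using svd B by (auto simp: is_svd_def)
  have Uk: "leading_cols k U \<in> carrier_mat nc k" and Sk: "leading_block k k S \<in> carrier_mat k k"
    and Vk: "leading_cols k V \<in> carrier_mat n k"
    using U V by (auto simp: leading_cols_def leading_block_def)
  have Ahat_carrier: "Ahat \<in> carrier_mat m n"
    unfolding Ahat using Q Vk by auto
  show ?thesis
  proof (rule spectral_norm_least)
    fix x assume "x \<in> carrier_vec (dim_col (Af - Ahat))" and x1: "vec_norm2 x \<le> 1"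
    then have x: "x \<in> carrier_vec n" using Ahat_carrier by simp
    define z where "z = Af *\<^sub>v x"
    define w where "w = EI *\<^sub>v x"
    define q where "q = R *\<^sub>v (M *\<^sub>v x)"
    define b where "b = leading_cols k U *\<^sub>v (leading_block k k S *\<^sub>v ((leading_cols k V)\<^sup>T *\<^sub>v x))"
    have carr: "z \<in> carrier_vec m" "w \<in> carrier_vec m" "q \<in> carrier_vec nc" "b \<in> carrier_vec nc"
      using Af EI R M Uk Sk Vk x by (auto intro!: mult_mat_vec_carrier simp: z_def w_def q_def b_def)
    have Mx: "M *\<^sub>v x \<in> carrier_vec nc" using M x by simp
    have QTz: "Q\<^sup>T *\<^sub>v z \<in> carrier_vec nc" using Q carr by simp
    have "Ac *\<^sub>v (M *\<^sub>v x) = Q *\<^sub>v q"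
      unfolding AcQR q_def using Q R Mx by (intro assoc_mult_mat_vec)
    then have "(Ac * M) *\<^sub>v x = Q *\<^sub>v q"
      using Ac M x by simp
    then have z: "z = Q *\<^sub>v q + w"
      using add_mult_distrib_mat_vec[of "Ac * M" m n EI x] Ac M EI x assms(9)
      by (simp add: z_def w_def)
    have Ahatx: "Ahat *\<^sub>v x = Q *\<^sub>v b"
    proof -
      have "Ahat *\<^sub>v x = (Q * leading_cols k U * leading_block k k S) *\<^sub>v ((leading_cols k V)\<^sup>T *\<^sub>v x)"
        unfolding Ahat using Q Uk Sk Vk x by (intro assoc_mult_mat_vec) auto
      also have "\<dots> = (Q * leading_cols k U) *\<^sub>v (leading_block k k S *\<^sub>v ((leading_cols k V)\<^sup>T *\<^sub>v x))"
        using Q Uk Sk Vk x by (intro assoc_mult_mat_vec) auto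
      also have "\<dots> = Q *\<^sub>v b"
        unfolding b_def using Q Uk Sk Vk x by (intro assoc_mult_mat_vec) auto
      finally show ?thesis .
    qed
    have "(Af - Ahat) *\<^sub>v x = z - Q *\<^sub>v b"
      using minus_mult_distrib_mat_vec[OF Af Ahat_carrier x] Ahatx by (simp add: z_def)
    also have "\<dots> = (z - Q *\<^sub>v (Q\<^sup>T *\<^sub>v z)) + Q *\<^sub>v (Q\<^sup>T *\<^sub>v z - b)"
      using Q carr mult_minus_distrib_mat_vec[OF Q(1) QTz carr(4)] by (intro eq_vecI) auto
    also have "z - Q *\<^sub>v (Q\<^sup>T *\<^sub>v z) = w - Q *\<^sub>v (Q\<^sup>T *\<^sub>v w)"
      unfolding z using Q carr(3,2) by (rule projection_residual_add_range)
    finally have "vec_norm2 ((Af - Ahat) *\<^sub>v x)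
        \<le> vec_norm2 (w - Q *\<^sub>v (Q\<^sup>T *\<^sub>v w)) + vec_norm2 (Q *\<^sub>v (Q\<^sup>T *\<^sub>v z - b))"
      using vec_norm2_triangle[of "w - Q *\<^sub>v (Q\<^sup>T *\<^sub>v w)" m] carr Q by simp
    moreover have "vec_norm2 (w - Q *\<^sub>v (Q\<^sup>T *\<^sub>v w)) \<le> spectral_norm EI"
    proof -
      have "vec_norm2 (w - Q *\<^sub>v (Q\<^sup>T *\<^sub>v w)) \<le> vec_norm2 w"
        using Q carr by (intro vec_norm2_projection_residual_le)
      also have "\<dots> \<le> spectral_norm EI"
        unfolding w_def using x x1 EI by (intro vec_norm2_le_spectral_norm) auto
      finally show ?thesis .
    qed
    moreover have "vec_norm2 (Q *\<^sub>v (Q\<^sup>T *\<^sub>v z - b)) \<le> singular_value Af (k + 1)"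
    proof -
      have "vec_norm2 (Q *\<^sub>v (Q\<^sup>T *\<^sub>v z - b)) = vec_norm2 (Q\<^sup>T *\<^sub>v z - b)"
        using Q carr by (intro vec_norm2_orthonormal_cols) auto
      also have "\<dots> = vec_norm2 ((Q\<^sup>T * Af) *\<^sub>v x - b)"
        using assoc_mult_mat_vec[of "Q\<^sup>T" nc m Af n x] Q Af x by (simp add: z_def)
      also have "\<dots> \<le> S $$ (k, k) * vec_norm2 x"
        unfolding b_def by (rule svd_truncation_error[OF svd B k x])
      also have "\<dots> \<le> S $$ (k, k)"
      proof (rule mult_left_le[OF x1])
        show "0 \<le> S $$ (k, k)"
          using svd k carrier_matD[OF B] unfolding is_svd_def by auto
      qed
      also have "\<dots> \<le> singular_value Af (k + 1)"
        by (rule compressed_singular_value_le[OF Q Af svd k])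
      finally show ?thesis .
    qed
    ultimately show "vec_norm2 ((Af - Ahat) *\<^sub>v x) \<le> singular_value Af (k + 1) + spectral_norm EI"
      by linarith
  qed
qed

end
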